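(* For every $n\in\mathbb{N}$, the polynomial $e_n$ of degree $n$ satisfying $e_n'(x)+e_n(x)=x^n$ is expressed through the associated Laguerre polynomial with upper index $-n-1$ by $$e_n(x)=n!\,L_n^{(-n-1)}(-x).$$
   Context: $\mathbb{N}=\{0,1,2,\dots\}$. $L_n^{(\alpha)}$ denotes the associated (generalized) Laguerre polynomial, $L_n^{(\alpha)}(x)=\frac{x^{-\alpha}e^{x}}{n!}\frac{d^n}{dx^n}\left(x^{n+\alpha}e^{-x}\right)=\sum_{k=0}^n(-1)^k\binom{n+\alpha}{n-k}\frac{x^k}{k!}$, where $\binom{a}{j}=\frac{a(a-1)\cdots(a-j+1)}{j!}$, extended to arbitrary real (in particular negative integer) $\alpha$. *)

theory Defs
  imports Complex_Main "HOL-Computational_Algebra.Polynomial"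
begin

(* The explicit sum serves as the definition since it makes sense for every real a,
   including negative integers; "gchoose" is a(a-1)...(a-j+1)/j! for real a. *)
definition laguerre :: "nat \<Rightarrow> real \<Rightarrow> real poly" where
  "laguerre n a = (\<Sum>k\<le>n. monom ((-1) ^ k * ((real n + a) gchoose (n - k)) / fact k) k)"

end

theory Submission
  imports Defs
begin

text \<open>With upper index -n-1 every binomial coefficient in the Laguerre sum is (-1 choose j), that is (-1)^j,
  so n! times the polynomial at -x is the alternating sum of the derivatives of x^n. Uniqueness holds
  because e' = -e is impossible by degree for a nonzero polynomial.\<close>

lemma pderiv_add_self_eq_0:
  fixes p :: "'a :: {idom, semiring_char_0} poly"
  assumes "pderiv p + p = 0"
  shows "p = 0"
proof (rule ccontr)
  assume "p \<noteq> 0"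
  have "degree p = degree (pderiv p)"
    using assms by (metis add_eq_0_iff degree_minus)
  \<comment> \<open>\<open>degree (pderiv p)\<close> is \<open>degree p - 1\<close> with truncated
    subtraction, so equality leaves only degree 0.\<close>
  then have "degree p = 0"
    by (simp add: degree_pderiv)
  then have "pderiv p = 0"
    by (simp add: pderiv_eq_0_iff)
  with assms \<open>p \<noteq> 0\<close> show False by simp
qed

text \<open>Negating the upper index turns -1 into 1 + k - 1 = k at the cost of (-1)^k, and (k
  choose k) = 1.\<close>

lemma gbinomial_minus_one: "((-1 :: 'a :: field_char_0) gchoose k) = (-1) ^ k"
  using gbinomial_minus[of "1 :: 'a" k] binomial_gbinomial[of k k, where ?'a = 'a] by simp

text \<open>The signs (-1)^k and (-1)^(n - k) merge, so the sign no longer depends on k; the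
  alternation in \<open>E\<close> below comes only from substituting -x.\<close>

lemma coeff_laguerre_minus_Suc:
  "coeff (laguerre n (- real n - 1)) k = (if k \<le> n then (-1) ^ n / fact k else 0)"
proof -
  have "coeff (laguerre n (- real n - 1)) k =
      (if k \<le> n then (-1) ^ k * (-1) ^ (n - k) / fact k else 0)"
    by (simp add: laguerre_def coeff_sum gbinomial_minus_one)
  then show ?thesis
    by (simp flip: power_add)
qed

theorem mainTheorem6:
  fixes n :: nat
  shows "(\<exists>!e :: real poly. degree e = n \<and> (\<forall>x. poly (pderiv e) x + poly e x = x ^ n)) \<and>
    (\<forall>e :: real poly. degree e = n \<and> (\<forall>x. poly (pderiv e) x + poly e x = x ^ n) \<longrightarrow>
      (\<forall>x. poly e x = fact n * poly (laguerre n (- real n - 1)) (- x)))"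
proof -
  define E :: "real poly" where
    "E = smult (fact n) (pcompose (laguerre n (- real n - 1)) [:0, -1:])"
  have coeff_E: "coeff E k = (if k \<le> n then (-1) ^ (n + k) * fact n / fact k else 0)" for k
    by (simp add: E_def coeff_pcompose_linear coeff_laguerre_minus_Suc power_add)
  have deg_E: "degree E = n"
    by (intro antisym degree_le le_degree) (simp_all add: coeff_E)
  have "pderiv E + E = monom 1 n"
  proof (rule poly_eqI)
    fix k
    \<comment> \<open>This recurrence makes the coefficients of \<open>pderiv E + E\<close> below
      degree n cancel. Expanding the fraction by \<open>Suc k\<close> turns \<open>fact k\<close>
      into \<open>fact (Suc k)\<close>.\<close>
    have Suc_coeff_E: "real (Suc k) * coeff E (Suc k) = - coeff E k" if "k < n"
    proof -
      have "coeff E k = real (Suc k) * ((-1) ^ (n + k) * fact n) / (real (Suc k) * fact k)"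
        using that by (simp add: coeff_E del: of_nat_Suc)
      also have "real (Suc k) * fact k = fact (Suc k)"
        by (rule fact_Suc[symmetric])
      finally show ?thesis
        using that by (simp add: coeff_E del: of_nat_Suc fact_Suc)
    qed
    consider "k < n" | "k = n" | "n < k" by linarith
    then show "coeff (pderiv E + E) k = coeff (monom 1 n) k"
    proof cases
      case 1
      with Suc_coeff_E show ?thesis by (simp add: coeff_pderiv del: of_nat_Suc)
    next
      \<comment> \<open>Here \<open>pderiv E\<close> contributes nothing, as
        \<open>coeff E (Suc n)\<close> is 0, and the leading coefficient of \<open>E\<close> is
        (-1)^(2n) = 1.\<close>
      case 2
      show ?thesis
        unfolding \<open>k = n\<close> by (simp add: coeff_pderiv coeff_E)
    next
      case 3
      then show ?thesis by (simp add: coeff_pderiv coeff_E)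
    qed
  qed
  \<comment> \<open>A real polynomial is determined by its values, so the pointwise equation can be
    compared coefficientwise.\<close>
  have ode_iff: "(\<forall>x. poly (pderiv e) x + poly e x = x ^ n) \<longleftrightarrow> pderiv e + e = monom 1 n"
    for e :: "real poly"
  proof -
    have "(\<forall>x. poly (pderiv e) x + poly e x = x ^ n) \<longleftrightarrow>
        poly (pderiv e + e) = poly (monom 1 n)"
      by (simp only: fun_eq_iff poly_add poly_monom mult_1)
    then show ?thesis
      by (simp only: poly_eq_poly_eq_iff)
  qed
  have unique: "e = E" if "pderiv e + e = monom 1 n" for e
  proof -
    \<comment> \<open>The difference of two solutions solves the homogeneous equation.\<close>
    have "pderiv (e - E) + (e - E) = (pderiv e + e) - (pderiv E + E)"
      by (simp only: pderiv_diff add_diff_add)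
    also have "\<dots> = 0"
      by (simp only: that \<open>pderiv E + E = monom 1 n\<close> diff_self)
    finally have "e - E = 0"
      by (rule pderiv_add_self_eq_0)
    then show ?thesis by simp
  qed
  have "poly E x = fact n * poly (laguerre n (- real n - 1)) (- x)" for x
    by (simp add: E_def poly_pcompose)
  with deg_E \<open>pderiv E + E = monom 1 n\<close> unique show ?thesis
    unfolding ode_iff by blast
qed

end
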